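(* Let $\varphi=\frac{1+\sqrt5}{2}$. If $q\in(\varphi,1+\sqrt{3}]$, then for every $\bar L\in[0,S(q)]$ there exists a binary control sequence $\mathbf u=(u_n)_{n\ge 0}\in\{0,1\}^\infty$ such that $$L(\mathbf u)=\bar L .$$
   Context: $(f_n)_{n\ge 0}$ is the Fibonacci sequence with $f_0=f_1=1$ and $f_{n+2}=f_{n+1}+f_n$ for all $n\ge 0$. $\{0,1\}^\infty$ is the set of infinite sequences $(u_0,u_1,u_2,\dots)$ with entries in $\{0,1\}$. For $q>\varphi$ and $\mathbf u=(u_n)\in\{0,1\}^\infty$, $$L(\mathbf u)=\sum_{n=0}^\infty \frac{u_n f_n}{q^n},\qquad S(q)=\sum_{n=0}^\infty \frac{f_n}{q^n}=\frac{q^2}{q^2-q-1};$$ both series converge for $q>\varphi$. *)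

theory Defs
  imports "HOL-Analysis.Analysis" "HOL-Number_Theory.Fib"
begin

definition phi :: real (\<open>\<phi>\<close>)
  where "\<phi> = (1 + sqrt 5) / 2"

text \<open>The library sequence \<^const>\<open>fib\<close> starts with 0, 1; here the indexing is shifted so that
  both initial values are 1.\<close>

definition f :: "nat \<Rightarrow> nat"
  where "f n = fib (Suc n)"

lemma f_0: "f 0 = 1" and f_1: "f 1 = 1" and f_rec: "f (n + 2) = f (n + 1) + f n"
  by (simp_all add: f_def)

definition binary_sequences :: "(nat \<Rightarrow> nat) set"
  where "binary_sequences = {u. \<forall>n. u n \<in> {0, 1}}"

definition L :: "real \<Rightarrow> (nat \<Rightarrow> nat) \<Rightarrow> real"
  where "L q u = (\<Sum>n. real (u n) * real (f n) / q ^ n)"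

definition S :: "real \<Rightarrow> real"
  where "S q = (\<Sum>n. real (f n) / q ^ n)"

text \<open>For \<open>q > \<phi>\<close> both series converge, so the uses of \<^const>\<open>suminf\<close> above are meaningful there.\<close>

lemma phi_gt_1: "1 < \<phi>"
proof -
  have "sqrt 1 < sqrt (5::real)" by (subst real_sqrt_less_iff) simp
  then show ?thesis by (simp add: phi_def)
qed

lemma phi_sq: "\<phi> ^ 2 = \<phi> + 1"
  by (simp add: phi_def power2_eq_square field_simps)

lemma f_le_phi_power: "real (f n) \<le> \<phi> ^ n"
proof (induction n rule: less_induct)
  case (less n)
  show ?case
  proof (cases "n < 2")
    case True
    then have "n = 0 \<or> n = 1" by auto
    then show ?thesis using phi_gt_1 f_0 f_1 by auto
  next
    case False
    then obtain m where n: "n = m + 2" by (metis add.commute le_Suc_ex not_less)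
    have "real (f n) = real (f (m + 1)) + real (f m)" by (simp only: n f_rec of_nat_add)
    also have "\<dots> \<le> \<phi> ^ (m + 1) + \<phi> ^ m" by (intro add_mono less) (simp_all add: n)
    also have "\<dots> = \<phi> ^ m * \<phi> ^ 2" by (simp only: phi_sq) (simp add: algebra_simps)
    finally show ?thesis by (simp only: n power_add)
  qed
qed

lemma summable_S:
  assumes "\<phi> < q"
  shows "summable (\<lambda>n. real (f n) / q ^ n)"
proof (rule summable_comparison_test')
  show "summable (\<lambda>n. (\<phi> / q) ^ n)"
    using assms phi_gt_1 by (intro summable_geometric) simp
  show "norm (real (f n) / q ^ n) \<le> (\<phi> / q) ^ n" if "n \<ge> 0" for n
    using assms phi_gt_1 f_le_phi_power[of n]
    by (simp add: power_divide divide_right_mono)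
qed

lemma summable_L:
  assumes "\<phi> < q" "u \<in> binary_sequences"
  shows "summable (\<lambda>n. real (u n) * real (f n) / q ^ n)"
proof (rule summable_comparison_test')
  show "summable (\<lambda>n. real (f n) / q ^ n)" by (rule summable_S) fact
  show "norm (real (u n) * real (f n) / q ^ n) \<le> real (f n) / q ^ n" if "n \<ge> 0" for n
  proof -
    have "u n = 0 \<or> u n = 1" using assms(2) by (auto simp: binary_sequences_def)
    then show ?thesis using assms(1) phi_gt_1 by auto
  qed
qed

lemma S_eq:
  assumes "\<phi> < q"
  shows "S q = q\<^sup>2 / (q\<^sup>2 - q - 1)"
proof -
  define a where "a = (\<lambda>n. real (f n) / q ^ n)"
  have q: "q > 1" using assms phi_gt_1 by simp
  have s: "summable a" unfolding a_def by (rule summable_S) fact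
  have s1: "summable (\<lambda>n. a (n + 1))" using s by (rule summable_ignore_initial_segment)
  have e1: "suminf a = (\<Sum>n. a (n + 1)) + 1"
    using suminf_split_initial_segment[OF s, of 1] f_0 by (simp add: a_def)
  have e2: "suminf a = (\<Sum>n. a (n + 2)) + (1 + 1 / q)"
    using suminf_split_initial_segment[OF s, of 2] f_0 f_1
    by (simp add: a_def numeral_2_eq_2)
  have "a (n + 2) = a (n + 1) / q + a n / q\<^sup>2" for n
    unfolding a_def f_rec using q by (simp add: field_simps power2_eq_square)
  then have "(\<Sum>n. a (n + 2)) = (\<Sum>n. a (n + 1)) / q + suminf a / q\<^sup>2"
    using s s1 by (simp add: suminf_add[symmetric] suminf_divide summable_divide)
  then have "suminf a = (suminf a - 1) / q + suminf a / q\<^sup>2 + 1 + 1 / q"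
    using e1 e2 by simp
  then have "suminf a * (q\<^sup>2 - q - 1) = q\<^sup>2"
    using q by (simp add: field_simps power2_eq_square)
  moreover from this have "q\<^sup>2 - q - 1 \<noteq> 0" using q by auto
  ultimately show ?thesis by (simp add: S_def a_def field_simps)
qed

end

theory Submission
  imports Defs
begin

text \<open>
  Kakeya's criterion: if every term of a convergent series of nonnegative reals is at most the
  sum of all later terms, then the subsums of the series fill the whole interval from zero to
  its sum. The greedy algorithm proves it. It keeps a remainder between zero and the tail that
  is still available: when the current term fits into the remainder, it is taken from both;
  when it does not, the remainder is smaller than the term, hence at most the next tail. The
  tails tend to zero, and so does the remainder.

  For the terms \<open>f n / q ^ n\<close> the criterion amounts to a bound on the tail. The recurrence of the
  sequence gives a linear equation for the tail that starts at \<open>n\<close>, and together with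
  \<open>f n \<le> f (n + 1)\<close> this shows that the tail is at least \<open>q\<^sup>2 / (q\<^sup>2 - q - 1)\<close> times its first
  term. That factor is at least two exactly when \<open>q\<^sup>2 \<le> 2 * q + 2\<close>, and the positive root of
  \<open>q\<^sup>2 - 2 * q - 2\<close> is \<open>1 + sqrt 3\<close>.
\<close>

primrec greedy_remainder :: "(nat \<Rightarrow> real) \<Rightarrow> real \<Rightarrow> nat \<Rightarrow> real" where
  "greedy_remainder a x 0 = x"
| "greedy_remainder a x (Suc n) =
     (let r = greedy_remainder a x n in if a n \<le> r then r - a n else r)"

definition greedy_digit :: "(nat \<Rightarrow> real) \<Rightarrow> real \<Rightarrow> nat \<Rightarrow> nat" where
  "greedy_digit a x n = (if a n \<le> greedy_remainder a x n then 1 else 0)"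

lemma greedy_digit_binary: "greedy_digit a x \<in> binary_sequences"
  by (simp add: binary_sequences_def greedy_digit_def)

lemma sum_greedy_digits:
  "(\<Sum>k<n. real (greedy_digit a x k) * a k) = x - greedy_remainder a x n"
  by (induction n) (simp_all add: greedy_digit_def Let_def)

lemma suminf_tail_Suc:
  fixes a :: "nat \<Rightarrow> real"
  assumes "summable a"
  shows "(\<Sum>k. a (k + n)) = a n + (\<Sum>k. a (k + Suc n))"
  using suminf_split_head[OF summable_ignore_initial_segment[OF assms, of n]]
  by simp

lemma suminf_tail_tendsto_0:
  fixes a :: "nat \<Rightarrow> real"
  assumes "summable a"
  shows "(\<lambda>n. \<Sum>k. a (k + n)) \<longlonglongrightarrow> 0"
proof -
  have "(\<lambda>n. suminf a - (\<Sum>k<n. a k)) \<longlonglongrightarrow> suminf a - suminf a"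
    by (intro tendsto_intros summable_LIMSEQ assms)
  then show ?thesis
    by (simp add: suminf_minus_initial_segment[OF assms])
qed

text \<open>When a term is rejected, the remainder is below that term; the hypothesis on the tails is
  what turns this into a bound by the next tail.\<close>

lemma greedy_remainder_bounds:
  assumes "summable a"
    and "\<And>n. a n \<le> (\<Sum>k. a (k + Suc n))"
    and "0 \<le> x" "x \<le> suminf a"
  shows "0 \<le> greedy_remainder a x n \<and> greedy_remainder a x n \<le> (\<Sum>k. a (k + n))"
proof (induction n)
  case 0
  then show ?case using assms(3,4) by simp
next
  case (Suc n)
  then show ?case
    using assms(2)[of n] suminf_tail_Suc[OF assms(1), of n] by (auto simp: Let_def)
qed

lemma greedy_digits_sums:
  assumes "summable a"
    and "\<And>n. a n \<le> (\<Sum>k. a (k + Suc n))"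
    and "0 \<le> x" "x \<le> suminf a"
  shows "(\<lambda>n. real (greedy_digit a x n) * a n) sums x"
proof -
  note bounds = greedy_remainder_bounds[OF assms]
  have "greedy_remainder a x \<longlonglongrightarrow> 0"
    by (rule tendsto_sandwich[OF _ _ tendsto_const suminf_tail_tendsto_0[OF assms(1)]])
      (simp_all add: bounds)
  then have "(\<lambda>n. x - greedy_remainder a x n) \<longlonglongrightarrow> x - 0"
    by (intro tendsto_intros)
  then show ?thesis
    by (simp add: sums_def sum_greedy_digits)
qed

text \<open>With \<open>a\<close> for the sequence of terms and \<open>r\<close> for the tail that starts at \<open>n\<close>, the recurrence
  turns the tail that starts at \<open>n + 2\<close> into \<open>(r - a n) / q + r / q\<^sup>2\<close>. Splitting the first two
  terms off \<open>r\<close> yields \<open>r * (1 - 1 / q - 1 / q\<^sup>2) = a n * (1 - 1 / q) + a (n + 1)\<close>, and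
  \<open>a (n + 1)\<close> is at least \<open>a n / q\<close>.\<close>

lemma fib_series_tail_lower_bound:
  assumes "\<phi> < q"
  shows "q\<^sup>2 * (real (f n) / q ^ n)
    \<le> (q\<^sup>2 - q - 1) * (\<Sum>k. real (f (k + n)) / q ^ (k + n))"
proof -
  define a where "a = (\<lambda>n. real (f n) / q ^ n)"
  define r where "r = (\<lambda>n. \<Sum>k. a (k + n))"
  have q: "q > 1" using assms phi_gt_1 by simp
  have s: "summable a" unfolding a_def by (rule summable_S) fact
  have st: "summable (\<lambda>k. a (k + m))" for m
    using s by (rule summable_ignore_initial_segment)
  have split: "r m = a m + r (Suc m)" for m
    unfolding r_def using s by (rule suminf_tail_Suc)
  have "a (m + 2) = a (m + 1) / q + a m / q\<^sup>2" for m
    unfolding a_def f_rec using q by (simp add: field_simps power2_eq_square)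
  from this[of "_ + n"] have "r (n + 2) = (\<Sum>k. a (k + Suc n) / q + a (k + n) / q\<^sup>2)"
    by (simp add: r_def add.assoc)
  also have "\<dots> = r (Suc n) / q + r n / q\<^sup>2"
    unfolding r_def using st[of n] st[of "Suc n"]
    by (simp only: suminf_add[symmetric] suminf_divide summable_divide)
  finally have rec: "r (n + 2) = r (Suc n) / q + r n / q\<^sup>2" .
  have "r n = a n + a (Suc n) + ((r n - a n) / q + r n / q\<^sup>2)"
    using split[of n] split[of "Suc n"] rec by simp
  then have "q\<^sup>2 * r n = q\<^sup>2 * (a n + a (Suc n) + ((r n - a n) / q + r n / q\<^sup>2))"
    by simp
  also have "\<dots> = q\<^sup>2 * a n + q\<^sup>2 * a (Suc n) + q * (r n - a n) + r n"
    using q by (simp add: field_simps power2_eq_square)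
  finally have eq: "(q\<^sup>2 - q - 1) * r n = q\<^sup>2 * a n + q * (q * a (Suc n) - a n)"
    by (simp add: algebra_simps power2_eq_square)
  have "a n \<le> q * a (Suc n)"
    using q by (simp add: a_def f_def divide_right_mono)
  then have "0 \<le> q * (q * a (Suc n) - a n)"
    using q by simp
  then have "q\<^sup>2 * a n \<le> (q\<^sup>2 - q - 1) * r n"
    unfolding eq by simp
  then show ?thesis by (simp add: a_def r_def)
qed

lemma fib_series_term_le_tail:
  assumes "\<phi> < q" "q \<le> 1 + sqrt 3"
  shows "real (f n) / q ^ n \<le> (\<Sum>k. real (f (k + Suc n)) / q ^ (k + Suc n))"
proof -
  define t where "t = real (f n) / q ^ n"
  define r where "r = (\<Sum>k. real (f (k + n)) / q ^ (k + n))"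
  have q: "q > 1" using assms(1) phi_gt_1 by simp
  have "q\<^sup>2 - q - 1 = (q - \<phi>) * (q + \<phi> - 1)"
    using phi_sq by (simp add: algebra_simps power2_eq_square)
  then have pos: "q\<^sup>2 - q - 1 > 0"
    using assms(1) q phi_gt_1 by simp
  have "(q - 1)\<^sup>2 \<le> (sqrt 3)\<^sup>2"
    using assms(2) q by (intro power_mono) auto
  then have "2 * (q\<^sup>2 - q - 1) \<le> q\<^sup>2"
    by (simp add: power2_eq_square algebra_simps)
  moreover have "t \<ge> 0" using q by (simp add: t_def)
  ultimately have "2 * (q\<^sup>2 - q - 1) * t \<le> q\<^sup>2 * t"
    by (rule mult_right_mono)
  also have "\<dots> \<le> (q\<^sup>2 - q - 1) * r"
    unfolding t_def r_def by (rule fib_series_tail_lower_bound) fact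
  finally have "(q\<^sup>2 - q - 1) * (2 * t) \<le> (q\<^sup>2 - q - 1) * r"
    by (simp only: mult.assoc mult.left_commute)
  then have "2 * t \<le> r"
    using pos by (simp only: mult_le_cancel_left_pos)
  then show ?thesis
    using suminf_tail_Suc[OF summable_S[OF assms(1)], of n]
    by (simp add: t_def r_def)
qed

theorem theorem3:
  fixes q :: real
  assumes "q \<in> {\<phi><..1 + sqrt 3}"
  shows "\<forall>Lbar \<in> {0..S q}. \<exists>u \<in> binary_sequences. L q u = Lbar"
proof
  fix Lbar assume Lbar: "Lbar \<in> {0..S q}"
  define a where "a = (\<lambda>n. real (f n) / q ^ n)"
  have q: "\<phi> < q" "q \<le> 1 + sqrt 3" using assms by auto
  have "(\<lambda>n. real (greedy_digit a Lbar n) * a n) sums Lbar"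
  proof (rule greedy_digits_sums)
    show "summable a" unfolding a_def using q(1) by (rule summable_S)
    show "a n \<le> (\<Sum>k. a (k + Suc n))" for n
      unfolding a_def using q by (rule fib_series_term_le_tail)
    show "0 \<le> Lbar" "Lbar \<le> suminf a" using Lbar by (simp_all add: a_def S_def)
  qed
  then have "L q (greedy_digit a Lbar) = Lbar"
    by (simp add: L_def a_def sums_iff)
  then show "\<exists>u \<in> binary_sequences. L q u = Lbar"
    using greedy_digit_binary by blast
qed

end
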